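(* Let $X$ be a sequentially weakly closed subset of a reflexive and separable real Banach space $E$, let $k$ be a positive integer, and let $\Phi:X\to\mathbf R$, $\Psi:X\to\,]-\infty,+\infty]$ be two functionals. Assume that there is a real number $\rho>\inf_X\Psi$ such that the set $(\overline{\Psi^{-1}(]-\infty,\rho[)})_w$ is bounded and has at least $k$ weakly connected components. Moreover, suppose that $\Phi$ is bounded below in $(\overline{\Psi^{-1}(]-\infty,\rho[)})_w$ and that the functional $\Psi+\lambda\Phi$ is sequentially weakly lower semicontinuous for each $\lambda>0$ small enough. Then there exists $\lambda^*>0$ such that, for each $\lambda\in\,]0,\lambda^*[$, the functional $\Psi+\lambda\Phi$ has at least $k$ $\tau_\Psi$-local minima lying in $\Psi^{-1}(]-\infty,\rho[)$, where $\tau$ is the relative weak topology of $X$.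
   Context: For a set $A$ in a Banach space, $(\overline A)_w$ denotes its closure in the weak topology; the weakly connected components of $A$ are its connected components in the weak topology. For a topology $\tau$ on $X$ and $\Psi:X\to\,]-\infty,+\infty]$ not identically $+\infty$, $\tau_\Psi$ denotes the smallest topology on $X$ containing both $\tau$ and the family of sets $\{\Psi^{-1}(]-\infty,s[)\}_{s\in\mathbf R}$. A $\tau_\Psi$-local minimum of a function $F$ on $X$ is a point $x\in X$ such that $F(x)\le F(y)$ for all $y$ in some $\tau_\Psi$-neighbourhood of $x$. "For each $\lambda>0$ small enough" means: there is $\lambda'>0$ such that the property holds for all $\lambda\in\,]0,\lambda']$. *)

theory Defs
  imports "HOL-Analysis.Analysis"
begin

definition canonical_embedding ::
    "'a::real_normed_vector \<Rightarrow> ('a \<Rightarrow>\<^sub>L real) \<Rightarrow>\<^sub>L real" where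
  "canonical_embedding x = Blinfun (\<lambda>f. blinfun_apply f x)"

lemma canonical_embedding_apply [simp]:
  "blinfun_apply (canonical_embedding x) f = blinfun_apply f x"
  unfolding canonical_embedding_def
  by (simp add: bounded_linear_Blinfun_apply blinfun.bounded_linear_left)

definition reflexive_space :: "'a::real_normed_vector itself \<Rightarrow> bool" where
  "reflexive_space _ \<longleftrightarrow> surj (canonical_embedding :: 'a \<Rightarrow> ('a \<Rightarrow>\<^sub>L real) \<Rightarrow>\<^sub>L real)"

definition weak_topology :: "'a::real_normed_vector topology" where
  "weak_topology =
     topology_generated_by {blinfun_apply f -` U | (f :: 'a \<Rightarrow>\<^sub>L real) U. open U}"

lemma topspace_weak_topology [simp]: "topspace weak_topology = UNIV"
proof -
  have "UNIV = blinfun_apply (0 :: 'a \<Rightarrow>\<^sub>L real) -` UNIV"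
    by simp
  then have "(UNIV :: 'a set) \<in> {blinfun_apply f -` U | (f :: 'a \<Rightarrow>\<^sub>L real) U. open U}"
    using open_UNIV by blast
  then show ?thesis
    unfolding weak_topology_def topology_generated_by_topspace by blast
qed

definition seq_closedin :: "'a topology \<Rightarrow> 'a set \<Rightarrow> bool" where
  "seq_closedin T S \<longleftrightarrow> S \<subseteq> topspace T \<and>
     (\<forall>u x. (\<forall>n. u n \<in> S) \<and> limitin T u x sequentially \<longrightarrow> x \<in> S)"

definition seq_lsc :: "'a topology \<Rightarrow> ('a \<Rightarrow> ereal) \<Rightarrow> bool" where
  "seq_lsc T F \<longleftrightarrow>
     (\<forall>u x. (\<forall>n. u n \<in> topspace T) \<and> limitin T u x sequentially \<longrightarrow>
        F x \<le> liminf (\<lambda>n. F (u n)))"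

text \<open>The coarsest refinement of the topology \<open>T\<close> in which all the sets
  \<open>{x \<in> topspace T. \<Psi> x < s}\<close>, with \<open>s\<close> real, are open.\<close>

definition sublevel_topology :: "'a topology \<Rightarrow> ('a \<Rightarrow> ereal) \<Rightarrow> 'a topology" where
  "sublevel_topology T \<Psi> =
     topology_generated_by
       ({U. openin T U} \<union> {{x \<in> topspace T. \<Psi> x < ereal s} | s. True})"

definition local_min_in :: "'a topology \<Rightarrow> ('a \<Rightarrow> ereal) \<Rightarrow> 'a \<Rightarrow> bool" where
  "local_min_in T F x \<longleftrightarrow> (\<exists>V. openin T V \<and> x \<in> V \<and> (\<forall>y\<in>V. F x \<le> F y))"

text \<open>\<^const>\<open>card\<close> alone would not do here, since \<open>S\<close> may be infinite.\<close>

definition has_at_least :: "nat \<Rightarrow> 'a set \<Rightarrow> bool" where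
  "has_at_least k S \<longleftrightarrow> (\<exists>D\<subseteq>S. finite D \<and> card D = k)"

end

theory Submission
  imports Defs
begin

text \<open>
  Write \<open>S = {x \<in> X. \<Psi> x < \<rho>}\<close> and let \<open>C\<close> be its weak closure. The local minima are global minima of
  \<open>\<Psi> + \<mu> \<Phi>\<close> over the pieces of a partition of \<open>C\<close>.

  A space with at least \<open>k\<close> components can be cut into \<open>k\<close> nonempty clopen pieces: as long as there
  are fewer pieces than components, some piece is disconnected and can be split
  (\<open>clopen_partition_of_components\<close>). Let \<open>A\<close> be such a piece of \<open>C\<close>. It is bounded and weakly closed,
  hence weakly compact, so \<open>\<Psi> + \<mu> \<Phi>\<close> has a minimum point \<open>x\<close> on it (\<open>seq_lsc_attains_min\<close>). Since \<open>S\<close>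
  is dense in \<open>C\<close> and \<open>A\<close> is relatively open, there is a point \<open>y\<close> in \<open>A \<inter> S\<close>. If \<open>m\<close> is a lower bound of
  \<open>\<Phi>\<close> on \<open>C\<close>, then
  \<open>\<Psi> x \<le> \<Psi> y + \<mu> (\<Phi> y - \<Phi> x) \<le> \<Psi> y + \<mu> (\<Phi> y - m)\<close>,
  which is below \<open>\<rho>\<close> as soon as \<open>\<mu>\<close> is small. For such \<open>\<mu>\<close> the minimum point lies in \<open>S\<close>. If \<open>U\<close> is a weakly
  open set with \<open>A = U \<inter> C\<close>, then \<open>S \<inter> U\<close> is a neighbourhood of \<open>x\<close> in the refined topology and is
  contained in \<open>A\<close>, so \<open>x\<close> is a local minimum. Distinct pieces give distinct points, and finitely many
  smallness conditions on \<open>\<mu>\<close> can be met together.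

  The functional-analytic input is the passage from topological to sequential notions. Closed bounded
  sets are weakly compact by Tychonoff's theorem and reflexivity
  (\<open>compactin_weak_topology_bounded_closed\<close>). Separability gives a sequence of functionals \<open>d\<^sub>n\<close> which
  tells apart all points that any functional tells apart (\<open>countable_functionals_determine_all\<close>).
  The map \<open>x \<mapsto> (d\<^sub>n x)\<^sub>n\<close> into the metrisable space of real sequences then detects weak convergence
  inside a weakly compact set (\<open>limitin_weak_topology_compact\<close>), so that there weak compactness implies
  sequential compactness and points of a closure are limits of sequences. The latter gives \<open>C \<subseteq> X\<close>.
\<close>

section \<open>Weak compactness in reflexive spaces\<close>

text \<open>The canonical embedding into the bidual, with the functionals on the dual regarded as points
  of the product space in which Tychonoff's theorem applies.\<close>

definition weak_evaluation :: "'a::real_normed_vector \<Rightarrow> ('a \<Rightarrow>\<^sub>L real) \<Rightarrow> real" where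
  "weak_evaluation x = (\<lambda>f. blinfun_apply f x)"

text \<open>The \<open>d\<^sub>n\<close> separate points as well as the whole dual does. Points with equal evaluations lie in the
  same weakly open sets, so weak convergence is insensitive to the difference between them.\<close>

definition determining_sequence :: "(nat \<Rightarrow> 'a::real_normed_vector \<Rightarrow>\<^sub>L real) \<Rightarrow> bool" where
  "determining_sequence d \<longleftrightarrow>
     (\<forall>x y. (\<forall>n. blinfun_apply (d n) x = blinfun_apply (d n) y)
        \<longrightarrow> weak_evaluation x = weak_evaluation y)"

lemma openin_weak_topology_functional:
  fixes f :: "'a::real_normed_vector \<Rightarrow>\<^sub>L real"
  assumes "open U"
  shows "openin weak_topology (blinfun_apply f -` U)"
  unfolding weak_topology_def by (rule topology_generated_by_Basis) (use assms in blast)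

text \<open>The weak topology is the coarsest one containing the generating sets, and all of these are
  open in the pullback of the product topology along the evaluation map.\<close>

lemma openin_weak_topology_imp_evaluation_vimage:
  fixes U :: "'a::real_normed_vector set"
  assumes "openin weak_topology U"
  obtains V where "open V" "U = weak_evaluation -` V"
proof -
  let ?T = "pullback_topology UNIV weak_evaluation (euclidean :: (('a \<Rightarrow>\<^sub>L real) \<Rightarrow> real) topology)"
  have basic: "openin ?T (blinfun_apply f -` W)" if "open W" for f :: "'a \<Rightarrow>\<^sub>L real" and W
  proof -
    have "open ((\<lambda>\<phi> :: ('a \<Rightarrow>\<^sub>L real) \<Rightarrow> real. \<phi> f) -` W)"
      by (rule open_vimage[OF that]) (rule continuous_on_product_coordinates)
    moreover have "blinfun_apply f -` W = weak_evaluation -` ((\<lambda>\<phi>. \<phi> f) -` W)"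
      by (auto simp: weak_evaluation_def)
    ultimately show ?thesis
      by (auto simp: openin_pullback_topology)
  qed
  have "generate_topology_on {blinfun_apply f -` W | (f :: 'a \<Rightarrow>\<^sub>L real) W. open W} U"
    using assms by (simp add: weak_topology_def openin_topology_generated_by_iff)
  then have "openin ?T U"
    by (rule generate_topology_on_coarsest[rotated 2]) (use basic in auto)
  then show ?thesis
    using that by (auto simp: openin_pullback_topology)
qed

text \<open>The linear \<open>\<phi>\<close> with \<open>\<bar>\<phi> f\<bar> \<le> R \<parallel>f\<parallel>\<close> for all \<open>f\<close> form a closed subset of a product of compact intervals.
  By reflexivity each of them is the evaluation at a point, so their compactness transfers to the set
  of these points, and that set contains every \<open>x\<close> of norm at most \<open>R\<close>.\<close>

lemma compactin_weak_topology_bounded_closed: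
  fixes C :: "'a::real_normed_vector set"
  assumes refl: "reflexive_space TYPE('a)"
    and bdd: "bounded C" and closed: "closedin weak_topology C"
  shows "compactin weak_topology C"
proof -
  obtain R where R: "\<And>x. x \<in> C \<Longrightarrow> norm x \<le> R"
    using bdd by (auto simp: bounded_iff)
  define P where "P = {\<phi> :: ('a \<Rightarrow>\<^sub>L real) \<Rightarrow> real. \<forall>f. \<bar>\<phi> f\<bar> \<le> R * norm f}"
  define L where "L = {\<phi> :: ('a \<Rightarrow>\<^sub>L real) \<Rightarrow> real. (\<forall>f g. \<phi> (f + g) = \<phi> f + \<phi> g)
                          \<and> (\<forall>r f. \<phi> (r *\<^sub>R f) = r * \<phi> f)}"
  define B where "B = {x :: 'a. weak_evaluation x \<in> P \<inter> L}"
  have "P = Pi\<^sub>E UNIV (\<lambda>f. cball 0 (R * norm f))"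
    by (auto simp: P_def)
  then have "compactin (product_topology (\<lambda>f. euclidean) UNIV) P"
    by (simp add: compactin_PiE)
  then have "compact P"
    by (simp add: euclidean_product_topology)
  moreover have "closed L"
    unfolding L_def
    by (intro closed_Collect_conj closed_Collect_all closed_Collect_eq continuous_intros
        continuous_on_product_coordinates)
  ultimately have PL: "compact (P \<inter> L)"
    by (rule compact_Int_closed)
  have surj: "\<exists>x. \<phi> = weak_evaluation x" if "\<phi> \<in> P \<inter> L" for \<phi>
  proof -
    have "bounded_linear \<phi>"
      by (rule bounded_linear_intro[where K = R]) (use that in \<open>auto simp: P_def L_def mult.commute\<close>)
    moreover obtain x where "Blinfun \<phi> = canonical_embedding x"
      using refl unfolding reflexive_space_def surj_def by blast
    ultimately have "\<phi> f = blinfun_apply f x" for f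
      by (metis bounded_linear_Blinfun_apply canonical_embedding_apply)
    then show ?thesis
      by (auto simp: weak_evaluation_def)
  qed
  have "compactin weak_topology B"
    unfolding compactin_def
  proof (intro conjI allI impI)
    fix \<U> :: "'a set set"
    assume \<U>: "Ball \<U> (openin weak_topology) \<and> B \<subseteq> \<Union>\<U>"
    then have "\<forall>U\<in>\<U>. \<exists>V. open V \<and> U = weak_evaluation -` V"
      by (meson openin_weak_topology_imp_evaluation_vimage)
    then obtain V where V: "\<And>U. U \<in> \<U> \<Longrightarrow> open (V U)" "\<And>U. U \<in> \<U> \<Longrightarrow> U = weak_evaluation -` V U"
      by metis
    have "P \<inter> L \<subseteq> (\<Union>U\<in>\<U>. V U)"
    proof
      fix \<phi> assume \<phi>: "\<phi> \<in> P \<inter> L"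
      then obtain x where x: "\<phi> = weak_evaluation x"
        using surj by blast
      then obtain U where "U \<in> \<U>" "x \<in> U"
        using \<U> \<phi> by (auto simp: B_def)
      then show "\<phi> \<in> (\<Union>U\<in>\<U>. V U)"
        using V(2) x by blast
    qed
    then obtain \<F> where \<F>: "\<F> \<subseteq> \<U>" "finite \<F>" "P \<inter> L \<subseteq> (\<Union>U\<in>\<F>. V U)"
      using compactE_image[OF PL, of \<U> V] V(1) by metis
    have "B \<subseteq> \<Union>\<F>"
    proof
      fix x assume "x \<in> B"
      then obtain U where "U \<in> \<F>" "weak_evaluation x \<in> V U"
        using \<F>(3) by (auto simp: B_def)
      then show "x \<in> \<Union>\<F>"
        using V(2) \<F>(1) by blast
    qed
    then show "\<exists>\<F>. finite \<F> \<and> \<F> \<subseteq> \<U> \<and> B \<subseteq> \<Union>\<F>"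
      using \<F> by blast
  qed simp
  moreover have "C \<subseteq> B"
  proof
    fix x assume "x \<in> C"
    have "\<bar>blinfun_apply f x\<bar> \<le> R * norm f" for f :: "'a \<Rightarrow>\<^sub>L real"
      using norm_blinfun[of f x] mult_left_mono[OF R[OF \<open>x \<in> C\<close>], of "norm f"]
      by (simp add: mult.commute)
    then show "x \<in> B"
      by (auto simp: B_def P_def L_def weak_evaluation_def blinfun.bilinear_simps)
  qed
  ultimately show ?thesis
    using closed closed_compactin by blast
qed

section \<open>Sequences in weakly compact sets\<close>

lemma countable_dense_subset:
  fixes S :: "'b::second_countable_topology set"
  obtains D where "countable D" "D \<subseteq> S" "S \<subseteq> closure D"
proof -
  have "second_countable (euclidean :: 'b topology)"
    unfolding second_countable_def
    by (metis (no_types) ex_countable_basis open_openin topological_basisE topological_basis_open)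
  then have "separable_space (top_of_set S)"
    by (intro second_countable_imp_separable_space second_countable_subtopology)
  then obtain D where "countable D" "D \<subseteq> S" "top_of_set S closure_of D = S"
    by (auto simp: separable_space_def)
  then show ?thesis
    using that by (metis Int_lower2 closure_of_subtopology euclidean_closure_of inf.absorb_iff2 inf_le2)
qed

text \<open>Restricting the functionals of the dual unit ball to a dense sequence \<open>q\<close> embeds the ball into the
  second countable space of real sequences. A countable subset \<open>D\<close> of the ball therefore has dense
  image. On the ball, evaluation is 1-Lipschitz, so this density passes from the points \<open>q n\<close> to all points
  \<open>z\<close>; in particular a point annihilated by \<open>D\<close> is annihilated by the whole dual.\<close>

lemma countable_functionals_determine_all:
  assumes sep: "separable_space (euclidean :: 'a::real_normed_vector topology)"
  obtains d :: "nat \<Rightarrow> 'a::real_normed_vector \<Rightarrow>\<^sub>L real"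
  where "determining_sequence d"
proof -
  obtain Q :: "'a set" where Q: "countable Q" "closure Q = UNIV"
    using sep by (auto simp: separable_space_def)
  then have "Q \<noteq> {}"
    by auto
  define q where "q = from_nat_into Q"
  have q: "range q = Q"
    using Q \<open>Q \<noteq> {}\<close> by (simp add: q_def)
  define B where "B = {f :: 'a \<Rightarrow>\<^sub>L real. norm f \<le> 1}"
  define r where "r = (\<lambda>(f :: 'a \<Rightarrow>\<^sub>L real) n. blinfun_apply f (q n))"
  obtain D0 where D0: "countable D0" "D0 \<subseteq> r ` B" "r ` B \<subseteq> closure D0"
    using countable_dense_subset[of "r ` B"] .
  obtain D where D: "countable D" "D \<subseteq> B" "D0 = r ` D"
    using D0 by (metis countable_subset_image)
  have unit_ball: "blinfun_apply f z = 0"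
    if f: "f \<in> B" and z: "\<And>g. g \<in> D \<Longrightarrow> blinfun_apply g z = 0" for f z
  proof (rule ccontr)
    assume "blinfun_apply f z \<noteq> 0"
    \<comment> \<open>One third each for replacing \<open>z\<close> by \<open>q n\<close> in \<open>f\<close>, \<open>f\<close> by \<open>g\<close> at \<open>q n\<close>, and \<open>q n\<close> by \<open>z\<close> in \<open>g\<close>.\<close>
    define e where "e = \<bar>blinfun_apply f z\<bar> / 3"
    have "e > 0"
      using \<open>blinfun_apply f z \<noteq> 0\<close> by (simp add: e_def)
    have "z \<in> closure Q"
      using Q by simp
    then obtain n where n: "dist (q n) z < e"
      using \<open>e > 0\<close> q unfolding closure_approachable by blast
    have "open ((\<lambda>\<phi> :: nat \<Rightarrow> real. \<phi> n) -` ball (blinfun_apply f (q n)) e)"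
      by (rule open_vimage[OF open_ball]) (rule continuous_on_product_coordinates)
    moreover have "r f \<in> (\<lambda>\<phi> :: nat \<Rightarrow> real. \<phi> n) -` ball (blinfun_apply f (q n)) e"
      using \<open>e > 0\<close> by (simp add: r_def)
    moreover have "r f \<in> closure D0"
      using D0 f by blast
    ultimately have "(\<lambda>\<phi> :: nat \<Rightarrow> real. \<phi> n) -` ball (blinfun_apply f (q n)) e \<inter> D0 \<noteq> {}"
      using open_Int_closure_eq_empty by blast
    then obtain g where g: "g \<in> D" "r g n \<in> ball (blinfun_apply f (q n)) e"
      unfolding D(3) by blast
    have bound: "\<bar>blinfun_apply h (q n) - blinfun_apply h z\<bar> < e" if "h \<in> B" for h
    proof -
      have "\<bar>blinfun_apply h (q n - z)\<bar> \<le> norm h * norm (q n - z)"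
        using norm_blinfun[of h "q n - z"] by simp
      also have "\<dots> \<le> norm (q n - z)"
        using that by (simp add: B_def mult_left_le_one_le)
      finally show ?thesis
        using n by (simp add: dist_norm blinfun.bilinear_simps)
    qed
    have "\<bar>blinfun_apply f z\<bar> < 3 * e"
      using bound[OF f] bound[of g] g D(2) z[OF g(1)] by (auto simp: r_def dist_real_def)
    then show False
      by (simp add: e_def)
  qed
  have all: "blinfun_apply f z = 0" if z: "\<And>g. g \<in> D \<Longrightarrow> blinfun_apply g z = 0"
    for f :: "'a \<Rightarrow>\<^sub>L real" and z
  proof (cases "f = 0")
    case False
    then have "(1 / norm f) *\<^sub>R f \<in> B"
      by (simp add: B_def)
    from unit_ball[OF this z] False show ?thesis
      by (simp add: blinfun.bilinear_simps)
  qed simp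
  have "blinfun_apply f x = blinfun_apply f y"
    if eq: "\<And>n. blinfun_apply (from_nat_into D n) x = blinfun_apply (from_nat_into D n) y"
    for x y and f :: "'a \<Rightarrow>\<^sub>L real"
  proof -
    have "blinfun_apply g (x - y) = 0" if "g \<in> D" for g
      using eq D(1) that by (metis blinfun.diff_right diff_self from_nat_into_surj)
    from all[OF this] show ?thesis
      by (simp add: blinfun.bilinear_simps)
  qed
  then have "determining_sequence (from_nat_into D)"
    unfolding determining_sequence_def weak_evaluation_def by (intro allI impI ext) blast
  then show ?thesis
    by (rule that)
qed

lemma continuous_map_weak_sequence_evaluation:
  "continuous_map weak_topology euclidean (\<lambda>x n. blinfun_apply (d n :: 'a::real_normed_vector \<Rightarrow>\<^sub>L real) x)"
proof -
  have "continuous_map weak_topology euclidean (blinfun_apply (d n))" for n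
    unfolding continuous_map_def
    using openin_weak_topology_functional[of _ "d n"]
    by (simp add: vimage_def)
  then have "continuous_map weak_topology (product_topology (\<lambda>_. euclidean) UNIV)
      (\<lambda>x n. blinfun_apply (d n) x)"
    by (simp add: continuous_map_componentwise_UNIV)
  then show ?thesis
    by (simp add: euclidean_product_topology)
qed

context
  fixes d :: "nat \<Rightarrow> 'a::real_normed_vector \<Rightarrow>\<^sub>L real" and K :: "'a set"
  assumes determine: "determining_sequence d"
    and K: "compactin weak_topology K"
begin

text \<open>If \<open>U\<close> is a weak neighbourhood of \<open>x\<close>, then \<open>K - U\<close> is weakly compact, so its image among the real
  sequences is compact and hence closed. This image does not contain the limit: a point with the same
  coordinates as \<open>x\<close> is weakly indistinguishable from \<open>x\<close> and thus lies in \<open>U\<close>. So eventually the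
  coordinates of \<open>u n\<close> are outside the image.\<close>

lemma limitin_weak_topology_compact:
  assumes "\<And>n. u n \<in> K"
    and lim: "(\<lambda>n. \<lambda>i. blinfun_apply (d i) (u n)) \<longlonglongrightarrow> (\<lambda>i. blinfun_apply (d i) x)"
  shows "limitin weak_topology u x sequentially"
  unfolding limitin_def
proof (intro conjI allI impI)
  fix U assume U: "openin weak_topology U \<and> x \<in> U"
  let ?e = "\<lambda>x i. blinfun_apply (d i) x"
  have "closedin weak_topology (UNIV - U)"
    using U by (metis closedin_diff closedin_topspace topspace_weak_topology)
  then have "compactin weak_topology (K - U)"
    using closed_Int_compactin[OF _ K] by (metis Diff_eq Compl_eq_Diff_UNIV Int_commute)
  then have "closed (?e ` (K - U))"
    using image_compactin[OF _ continuous_map_weak_sequence_evaluation]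
    by (metis compact_imp_closed compactin_euclidean_iff)
  moreover have "?e x \<notin> ?e ` (K - U)"
  proof
    assume "?e x \<in> ?e ` (K - U)"
    then obtain y where y: "y \<in> K - U" "?e x = ?e y"
      by blast
    obtain V where V: "U = weak_evaluation -` V"
      using U openin_weak_topology_imp_evaluation_vimage by metis
    have "weak_evaluation x = weak_evaluation y"
      using determine y(2) unfolding determining_sequence_def fun_eq_iff by blast
    then show False
      using U y(1) V by auto
  qed
  ultimately have "\<forall>\<^sub>F n in sequentially. ?e (u n) \<in> - ?e ` (K - U)"
    using lim by (intro topological_tendstoD) auto
  then show "\<forall>\<^sub>F n in sequentially. u n \<in> U"
    by eventually_elim (use assms(1) in blast)
qed simp

lemma weak_sequential_compactness:
  fixes u :: "nat \<Rightarrow> 'a"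
  assumes "\<And>n. u n \<in> K"
  obtains x r where "x \<in> K" "strict_mono r" "limitin weak_topology (u \<circ> r) x sequentially"
proof -
  let ?e = "\<lambda>x i. blinfun_apply (d i) x"
  have "compact (?e ` K)"
    using image_compactin[OF K continuous_map_weak_sequence_evaluation[of d]]
    by (simp add: compactin_euclidean_iff)
  then have "seq_compact (?e ` K)"
    by (simp add: seq_compact_eq_compact)
  moreover have "\<forall>n. ?e (u n) \<in> ?e ` K"
    using assms by blast
  ultimately obtain l r where "l \<in> ?e ` K" "strict_mono r" "((\<lambda>n. ?e (u n)) \<circ> r) \<longlonglongrightarrow> l"
    by (rule seq_compactE[where f = "\<lambda>n. ?e (u n)"])
  then obtain x where "x \<in> K" "(\<lambda>n. ?e ((u \<circ> r) n)) \<longlonglongrightarrow> ?e x"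
    by (auto simp: o_def)
  with \<open>strict_mono r\<close> show ?thesis
    using that limitin_weak_topology_compact[of "u \<circ> r" x] assms by simp
qed

lemma weak_closure_sequential:
  assumes "S \<subseteq> K" "x \<in> weak_topology closure_of S"
  obtains s where "\<forall>n. s n \<in> S" "limitin weak_topology s x sequentially"
proof -
  let ?e = "\<lambda>x i. blinfun_apply (d i) x"
  have "?e ` (weak_topology closure_of S) \<subseteq> closure (?e ` S)"
    using continuous_map_image_closure_subset[OF continuous_map_weak_sequence_evaluation[of d]]
    by (metis euclidean_closure_of)
  then have "?e x \<in> closure (?e ` S)"
    using assms(2) by blast
  then obtain t where t: "\<And>n. t n \<in> ?e ` S" "t \<longlonglongrightarrow> ?e x"
    unfolding closure_sequential by blast
  then have "\<forall>n. \<exists>y. y \<in> S \<and> t n = ?e y"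
    by blast
  then obtain s where s: "\<And>n. s n \<in> S" "\<And>n. t n = ?e (s n)"
    by metis
  have "limitin weak_topology s x sequentially"
    by (rule limitin_weak_topology_compact) (use s assms(1) t(2)[unfolded s(2)[THEN ext]] in auto)
  with s(1) show ?thesis
    using that by blast
qed

text \<open>The direct method: a weakly convergent subsequence of a minimising sequence. In the
  extended reals the infimum is a limit of values even when it is \<open>-\<infinity>\<close>.\<close>

lemma seq_lsc_attains_min:
  assumes lsc: "seq_lsc (subtopology weak_topology X) F" and "K \<subseteq> X" "K \<noteq> {}"
  obtains x where "x \<in> K" "\<forall>y\<in>K. F x \<le> F y"
proof -
  obtain v where v: "\<And>n. v n \<in> F ` K" "v \<longlonglongrightarrow> Inf (F ` K)"
    using Inf_as_limit[of "F ` K"] \<open>K \<noteq> {}\<close> by auto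
  then have "\<forall>n. \<exists>y. y \<in> K \<and> v n = F y"
    by blast
  then obtain u where u: "\<And>n. u n \<in> K" "\<And>n. v n = F (u n)"
    by metis
  obtain x r where x: "x \<in> K" and "strict_mono r"
      and lim: "limitin weak_topology (u \<circ> r) x sequentially"
    using weak_sequential_compactness[OF u(1)] .
  have "(\<lambda>n. F ((u \<circ> r) n)) \<longlonglongrightarrow> Inf (F ` K)"
    using LIMSEQ_subseq_LIMSEQ[OF v(2) \<open>strict_mono r\<close>] u(2) by (simp add: o_def)
  then have "liminf (\<lambda>n. F ((u \<circ> r) n)) = Inf (F ` K)"
    by (simp add: lim_imp_Liminf)
  moreover have "F x \<le> liminf (\<lambda>n. F ((u \<circ> r) n))"
  proof -
    have "\<forall>n. (u \<circ> r) n \<in> X" "x \<in> X"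
      using u(1) x \<open>K \<subseteq> X\<close> by auto
    then show ?thesis
      using lsc lim unfolding seq_lsc_def limitin_subtopology
      by (metis UNIV_I eventually_sequentiallyI inf_top_left topspace_subtopology topspace_weak_topology)
  qed
  ultimately have "F x \<le> F y" if "y \<in> K" for y
    using that by (simp add: Inf_lower order_trans)
  with x show ?thesis
    using that by blast
qed

end

section \<open>Local minima on clopen pieces\<close>

text \<open>The pieces come pairwise separated and, being finitely many, each is separated from the union of
  the others. Two separated sets that cover the space are clopen.\<close>

lemma clopen_partition_of_components:
  assumes "has_at_least k (connected_components_of T)" "0 < k"
  obtains \<U> where "finite \<U>" "card \<U> = k" "disjoint \<U>" "{} \<notin> \<U>"
    "\<forall>U\<in>\<U>. openin T U" "\<forall>U\<in>\<U>. closedin T U"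
proof -
  have "{..<k} \<lesssim> connected_components_of T"
  proof -
    obtain D where D: "D \<subseteq> connected_components_of T" "finite D" "card D = k"
      using assms(1) by (auto simp: has_at_least_def)
    then have "D \<approx> {..<k}"
      by (simp add: eqpoll_iff_finite_card)
    then show ?thesis
      using D(1) by (meson eqpoll_sym eqpoll_imp_lepoll lepoll_trans subset_imp_lepoll)
  qed
  then obtain \<U> where "\<U> \<approx> {..<k}" and sep: "pairwise (separatedin T) \<U>"
      and "{} \<notin> \<U>" and cover: "\<Union>\<U> = topspace T"
    using lepoll_connected_components_alt[of k T] assms(2) by auto
  then have "finite \<U>" "card \<U> = k"
    by (simp_all add: eqpoll_iff_finite_card)
  moreover have "disjoint \<U>"
    using sep by (auto simp: pairwise_def dest: separatedin_imp_disjoint)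
  moreover have "openin T U \<and> closedin T U" if "U \<in> \<U>" for U
  proof -
    have "U \<subseteq> topspace T"
      using cover that by blast
    then have "separatedin T U (\<Union>(\<U> - {U}))"
      using sep that \<open>finite \<U>\<close> by (auto simp: separatedin_Union pairwise_def)
    moreover have "U \<union> \<Union>(\<U> - {U}) = topspace T"
      using cover that by blast
    ultimately show ?thesis
      by (simp add: separatedin_full)
  qed
  ultimately show ?thesis
    using that \<open>{} \<notin> \<U>\<close> by blast
qed

lemma small_perturbation_stays_below:
  fixes p \<rho> c :: real
  assumes "p < \<rho>"
  shows "\<forall>\<^sub>F \<mu> in at_right 0. p + \<mu> * c < \<rho>"
proof -
  have "((\<lambda>\<mu>. p + \<mu> * c) \<longlongrightarrow> p + 0 * c) (at_right 0)"
    by (intro tendsto_intros)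
  then show ?thesis
    using assms by (intro order_tendstoD) simp_all
qed

theorem theorem5:
  fixes X :: "'a::banach set"
    and \<Phi> :: "'a \<Rightarrow> real"
    and \<Psi> :: "'a \<Rightarrow> ereal"
    and k :: nat
    and \<rho> :: real
  assumes reflexive: "reflexive_space TYPE('a)"
    and separable: "separable_space (euclidean :: 'a topology)"
    and X_closed: "seq_closedin weak_topology X"
    and k_pos: "0 < k"
    and \<Psi>_range: "\<And>x. x \<in> X \<Longrightarrow> \<Psi> x \<noteq> -\<infinity>"
    and \<rho>_gt: "(INF x\<in>X. \<Psi> x) < ereal \<rho>"
    and bounded_closure: "bounded (weak_topology closure_of {x \<in> X. \<Psi> x < ereal \<rho>})"
    and components: "has_at_least k (connected_components_of
           (subtopology weak_topology (weak_topology closure_of {x \<in> X. \<Psi> x < ereal \<rho>})))"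
    and \<Phi>_bdd_below: "bdd_below (\<Phi> ` (weak_topology closure_of {x \<in> X. \<Psi> x < ereal \<rho>}))"
    and lsc: "\<exists>\<mu>'>0. \<forall>\<mu>\<in>{0<..\<mu>'}.
           seq_lsc (subtopology weak_topology X) (\<lambda>x. \<Psi> x + ereal (\<mu> * \<Phi> x))"
  shows "\<exists>\<mu>_star>0. \<forall>\<mu>\<in>{0<..<\<mu>_star}.
           has_at_least k {x \<in> X. \<Psi> x < ereal \<rho> \<and>
             local_min_in (sublevel_topology (subtopology weak_topology X) \<Psi>)
               (\<lambda>x. \<Psi> x + ereal (\<mu> * \<Phi> x)) x}"
proof -
  define S where "S = {x \<in> X. \<Psi> x < ereal \<rho>}"
  define C where "C = weak_topology closure_of S"
  define F where "F = (\<lambda>\<mu> x. \<Psi> x + ereal (\<mu> * \<Phi> x))"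
  define M where "M = (\<lambda>\<mu>. {x \<in> X. \<Psi> x < ereal \<rho> \<and>
             local_min_in (sublevel_topology (subtopology weak_topology X) \<Psi>) (F \<mu>) x})"
  have "S \<subseteq> C"
    unfolding C_def by (rule closure_of_subset) simp
  have "closedin weak_topology C"
    unfolding C_def by simp
  have compact_C: "compactin weak_topology C"
    by (rule compactin_weak_topology_bounded_closed[OF reflexive])
       (use bounded_closure in \<open>simp_all add: C_def S_def\<close>)
  obtain d :: "nat \<Rightarrow> 'a \<Rightarrow>\<^sub>L real"
    where d: "determining_sequence d"
    using countable_functionals_determine_all[OF separable] .
  \<comment> \<open>The points of \<open>C\<close> are weak limits of sequences in \<open>S\<close>, and \<open>X\<close> is closed under such limits.\<close>
  have "C \<subseteq> X"
  proof
    fix x assume "x \<in> C"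
    then obtain s where "\<forall>n. s n \<in> S" "limitin weak_topology s x sequentially"
      unfolding C_def by (rule weak_closure_sequential[OF d compact_C \<open>S \<subseteq> C\<close>])
    then show "x \<in> X"
      using X_closed unfolding seq_closedin_def S_def by blast
  qed
  obtain m where m: "\<And>x. x \<in> C \<Longrightarrow> m \<le> \<Phi> x"
    using \<Phi>_bdd_below unfolding bdd_below_def C_def S_def by auto
  obtain \<U> where \<U>: "finite \<U>" "card \<U> = k" "disjoint \<U>" "{} \<notin> \<U>"
    and \<U>_open: "\<forall>A\<in>\<U>. openin (subtopology weak_topology C) A"
    and \<U>_closed: "\<forall>A\<in>\<U>. closedin (subtopology weak_topology C) A"
    by (rule clopen_partition_of_components[OF components[folded S_def, folded C_def] k_pos])
  have ev_lsc: "\<forall>\<^sub>F \<mu> in at_right 0. seq_lsc (subtopology weak_topology X) (F \<mu>)"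
  proof -
    obtain \<mu>' where "0 < \<mu>'" "\<And>\<mu>. 0 < \<mu> \<Longrightarrow> \<mu> \<le> \<mu>' \<Longrightarrow>
        seq_lsc (subtopology weak_topology X) (F \<mu>)"
      using lsc by (auto simp: F_def)
    then show ?thesis
      unfolding eventually_at_right_field by (intro exI[of _ \<mu>']) auto
  qed
  have "\<forall>\<^sub>F \<mu> in at_right 0. \<exists>x. x \<in> A \<inter> M \<mu>" if A: "A \<in> \<U>" for A
  proof -
    obtain U where U: "openin weak_topology U" "A = U \<inter> C"
      using bspec[OF \<U>_open A] by (auto simp: openin_subtopology)
    have "A \<subseteq> C" "A \<noteq> {}"
      using U \<U>(4) A by auto
    have "closedin weak_topology A"
      using bspec[OF \<U>_closed A] \<open>closedin weak_topology C\<close> closedin_trans_full by blast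
    then have compact_A: "compactin weak_topology A"
      using closed_compactin[OF compact_C \<open>A \<subseteq> C\<close>] by blast
    obtain y where y: "y \<in> A" "y \<in> S"
    proof -
      obtain z where "z \<in> U" "z \<in> C"
        using U(2) \<open>A \<noteq> {}\<close> by blast
      then obtain y where "y \<in> S" "y \<in> U"
        using U(1) unfolding C_def in_closure_of by blast
      with that show ?thesis
        using U(2) \<open>S \<subseteq> C\<close> by blast
    qed
    then have "y \<in> X" "\<Psi> y < ereal \<rho>"
      by (auto simp: S_def)
    then obtain p where p: "\<Psi> y = ereal p" "p < \<rho>"
      using \<Psi>_range[of y] by (cases "\<Psi> y") auto
    have "\<forall>\<^sub>F \<mu> in at_right 0. p + \<mu> * (\<Phi> y - m) < \<rho>"
      using p by (intro small_perturbation_stays_below)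
    moreover have "\<forall>\<^sub>F \<mu> in at_right 0. (0::real) < \<mu>"
      by (rule eventually_at_right_less)
    ultimately show ?thesis
      using ev_lsc
    proof eventually_elim
      case (elim \<mu>)
      have "A \<subseteq> X"
        using \<open>A \<subseteq> C\<close> \<open>C \<subseteq> X\<close> by blast
      then obtain x where x: "x \<in> A" "\<forall>z\<in>A. F \<mu> x \<le> F \<mu> z"
        using \<open>A \<noteq> {}\<close> by (rule seq_lsc_attains_min[OF d compact_A elim(3)])
      have "x \<in> X" "m \<le> \<Phi> x"
        using x \<open>A \<subseteq> C\<close> \<open>C \<subseteq> X\<close> m by auto
      \<comment> \<open>Comparing the minimum with the value at \<open>y\<close> forces \<open>x\<close> into the sublevel set.\<close>
      have "\<Psi> x + ereal (\<mu> * \<Phi> x) \<le> ereal (p + \<mu> * \<Phi> y)"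
        using bspec[OF x(2) y(1)] p by (simp add: F_def)
      then have "\<Psi> x \<le> ereal (p + \<mu> * \<Phi> y - \<mu> * \<Phi> x)"
        by (cases "\<Psi> x") auto
      also have "\<dots> \<le> ereal (p + \<mu> * (\<Phi> y - m))"
        using \<open>m \<le> \<Phi> x\<close> elim(2) by (simp add: algebra_simps)
      also have "\<dots> < ereal \<rho>"
        using elim(1) by simp
      finally have "\<Psi> x < ereal \<rho>" .
      let ?T = "sublevel_topology (subtopology weak_topology X) \<Psi>"
      have "openin ?T S"
        unfolding sublevel_topology_def S_def by (rule topology_generated_by_Basis) auto
      moreover have "openin ?T (X \<inter> U)"
        unfolding sublevel_topology_def
        by (rule topology_generated_by_Basis) (use U(1) openin_subtopology_Int2 in blast)
      ultimately have "openin ?T (S \<inter> (X \<inter> U))"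
        by (rule openin_Int)
      moreover have "x \<in> S \<inter> (X \<inter> U)"
        using x(1) U \<open>x \<in> X\<close> \<open>\<Psi> x < ereal \<rho>\<close> by (simp add: S_def)
      moreover have "F \<mu> x \<le> F \<mu> z" if "z \<in> S \<inter> (X \<inter> U)" for z
        using x(2) that U(2) \<open>S \<subseteq> C\<close> by blast
      ultimately have "local_min_in ?T (F \<mu>) x"
        unfolding local_min_in_def by blast
      then show ?case
        using x(1) \<open>x \<in> X\<close> \<open>\<Psi> x < ereal \<rho>\<close> by (auto simp: M_def)
    qed
  qed
  then have "\<forall>\<^sub>F \<mu> in at_right 0. \<forall>A\<in>\<U>. \<exists>x. x \<in> A \<inter> M \<mu>"
    using \<U>(1) by (simp add: eventually_ball_finite)
  then have "\<forall>\<^sub>F \<mu> in at_right 0. has_at_least k (M \<mu>)"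
  proof eventually_elim
    case (elim \<mu>)
    then obtain g where "\<forall>A\<in>\<U>. g A \<in> A \<inter> M \<mu>"
      by (rule bchoice[THEN exE])
    then have g: "\<And>A. A \<in> \<U> \<Longrightarrow> g A \<in> A \<inter> M \<mu>"
      by blast
    have "inj_on g \<U>"
    proof (rule inj_onI)
      fix A B
      assume AB: "A \<in> \<U>" "B \<in> \<U>" "g A = g B"
      then have "g A \<in> A \<inter> B"
        using g[of A] g[of B] by auto
      then show "A = B"
        using \<U>(3) AB(1,2) by (auto simp: pairwise_def disjnt_def)
    qed
    then have "card (g ` \<U>) = k"
      using \<U>(2) card_image by blast
    moreover have "g ` \<U> \<subseteq> M \<mu>"
      using g by blast
    ultimately show ?case
      using \<U>(1) unfolding has_at_least_def by blast
  qed
  then obtain b where "0 < b" "\<And>\<mu>. 0 < \<mu> \<Longrightarrow> \<mu> < b \<Longrightarrow> has_at_least k (M \<mu>)"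
    unfolding eventually_at_right_field by blast
  then show ?thesis
    unfolding M_def F_def by (intro exI[of _ b]) simp
qed

end
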